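(* Let $A\in x^{-m}\mathrm{Diff}^m_b(M;E)$ be $c$-elliptic, let $d=\dim\mathcal E_{\max}$ and let $0<d_0<d$. Let $\mathcal W\in\mathrm{Gr}_{d_0}(\mathcal E_{\max})$ and let $\mathcal V\in\mathrm{Gr}_{d-d_0}(\mathcal E_{\max})\setminus\mathfrak V_{\mathcal W}$, i.e. $\mathcal V\cap\mathcal W=0$. Let $\pi_{\mathcal V,\mathcal W}:\mathcal E_{\max}\to\mathcal E_{\max}$ be the projection on $\mathcal V$ according to $\mathcal E_{\max}=\mathcal V\oplus\mathcal W$. Then $$\|\pi_{\mathcal V,\mathcal W}\|\le\frac{C}{\delta(\mathcal V,\mathcal W)},$$ where the constant $C$ is independent of $\mathcal V$.
   Context: $M$ is a compact smooth manifold with nonempty boundary $Y$ and interior $\mathring M$, $E\to M$ a Hermitian vector bundle, $\mathfrak m$ a smooth positive $b$-density, $x$ a boundary defining function. $A=x^{-m}P$ with $P$ a differential operator of order $m$ which near $Y$ has the form $\sum_{k+|\alpha|\le m}a_{k\alpha}(x,y)D_y^\alpha(xD_x)^k$, $a_{k\alpha}$ smooth up to $x=0$; $c$-elliptic means that the principal symbol of $A$ is invertible over $\mathring M$ (off the zero section) and near $Y$ the matrix $\sum_{k+|\alpha|=m}a_{k\alpha}(x,y)\eta^\alpha\xi^k$ is invertible for all real $(\xi,\eta)\ne0$, including at $x=0$. In $x^{-m/2}L^2_b(M;E)=L^2(M,x^m\mathfrak m;E)$, $\mathcal D_{\min}$ is the domain of the closure of $A$ on $C_0^\infty(\mathring M;E)$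 and $\mathcal D_{\max}=\{u\in x^{-m/2}L^2_b:Au\in x^{-m/2}L^2_b\}$ with inner product $(u,v)_A=(Au,Av)+(u,v)$. $\mathcal E_{\max}$ is the orthogonal complement of $\mathcal D_{\min}$ in $\mathcal D_{\max}$, a finite dimensional Hilbert space (only this is relevant to the statement). $\mathrm{Gr}_k(\mathcal E_{\max})$ is the Grassmannian of $k$-dimensional complex subspaces; $\mathfrak V_{\mathcal W}=\{\mathcal V\in\mathrm{Gr}_{d-d_0}(\mathcal E_{\max}):\mathcal V\cap\mathcal W\ne0\}$. Definition of $\delta$: fix an ordered orthonormal basis $\mathbf u$ of $\mathcal E_{\max}$. For $\mathcal V\in\mathrm{Gr}_{d-d_0}(\mathcal E_{\max})$ and $\mathcal W\in\mathrm{Gr}_{d_0}(\mathcal E_{\max})$ choose ordered orthonormal bases of $\mathcal V$ and $\mathcal W$, and let $V$ (size $d\times(d-d_0)$) and $W$ (size $d\times d_0$) be the matrices whose columns are their coordinates in $\mathbf u$. Then $\delta(\mathcal V,\mathcal W)=|\det[V|W]|$, which does not depend on the chosen orthonormal bases of $\mathcal V$ and $\mathcal W$. The norm of $\pi_{\mathcal V,\mathcal W}$ is the operator norm on $\mathcal E_{\max}$. *)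

theory Defs
  imports
    "HOL-Analysis.Inner_Product"
    "HOL-Analysis.Operator_Norm"
    "Jordan_Normal_Form.Determinant"
begin

text \<open>
  Complex inner product spaces. They are built on top of \<^class>\<open>real_inner\<close>, whose inner product is
  required to be the real part of the Hermitian one, so that \<^const>\<open>norm\<close> is the Hilbert space norm
  and the library's \<^const>\<open>onorm\<close> is the operator norm.
\<close>

class scaleC =
  fixes scaleC :: "complex \<Rightarrow> 'a \<Rightarrow> 'a"  (infixr \<open>*\<^sub>C\<close> 75)

class complex_vector = real_vector + scaleC +
  assumes scaleC_add_right: "a *\<^sub>C (x + y) = a *\<^sub>C x + a *\<^sub>C y"
    and scaleC_add_left: "(a + b) *\<^sub>C x = a *\<^sub>C x + b *\<^sub>C x"
    and scaleC_scaleC: "a *\<^sub>C b *\<^sub>C x = (a * b) *\<^sub>C x"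
    and scaleC_one: "1 *\<^sub>C x = x"
    and scaleR_scaleC: "r *\<^sub>R x = complex_of_real r *\<^sub>C x"

interpretation complex_vector: vector_space "scaleC :: complex \<Rightarrow> 'a \<Rightarrow> 'a::complex_vector"
  by unfold_locales
    (simp_all add: scaleC_add_right scaleC_add_left scaleC_scaleC scaleC_one)

class complex_inner = complex_vector + real_inner +
  fixes cinner :: "'a \<Rightarrow> 'a \<Rightarrow> complex"
  assumes cinner_commute: "cinner x y = cnj (cinner y x)"
    and cinner_add_left: "cinner (x + y) z = cinner x z + cinner y z"
    and cinner_scaleC_left: "cinner (a *\<^sub>C x) y = a * cinner x y"
    and inner_eq_Re_cinner: "inner x y = Re (cinner x y)"

lemma cinner_self:
  fixes x :: "'a::complex_inner"
  shows "cinner x x = complex_of_real ((norm x)\<^sup>2)"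
proof (rule complex_eqI)
  have "Im (cinner x x) = - Im (cinner x x)"
    by (metis cinner_commute cnj.simps(2))
  then show "Im (cinner x x) = Im (complex_of_real ((norm x)\<^sup>2))" by simp
qed (simp add: power2_norm_eq_inner inner_eq_Re_cinner)

text \<open>Completeness is automatic in finite dimension.\<close>

class fd_complex_hilbert = complex_inner +
  assumes finite_spanning_set:
    "\<exists>B. finite B \<and> (\<forall>x. \<exists>f. x = (\<Sum>b\<in>B. f b *\<^sub>C b))"

definition Gr :: "nat \<Rightarrow> 'e::fd_complex_hilbert set set" where
  "Gr k = {V. complex_vector.subspace V \<and> complex_vector.dim V = k}"

definition frakV :: "'e::fd_complex_hilbert set \<Rightarrow> 'e set set" where
  "frakV W = {V \<in> Gr (complex_vector.dim (UNIV :: 'e set) - complex_vector.dim W). V \<inter> W \<noteq> {0}}"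

definition orthonormal_basis :: "'e::complex_inner list \<Rightarrow> 'e set \<Rightarrow> bool" where
  "orthonormal_basis vs V \<longleftrightarrow>
     (\<forall>i<length vs. \<forall>j<length vs. cinner (vs ! i) (vs ! j) = (if i = j then 1 else 0)) \<and>
     complex_vector.span (set vs) = V"

definition coord_mat :: "'e::complex_inner list \<Rightarrow> 'e list \<Rightarrow> complex mat" where
  "coord_mat u vs = mat (length u) (length vs)
     (\<lambda>(i, j). complex_vector.representation (set u) (vs ! j) (u ! i))"

text \<open>The block matrix \<open>[A|B]\<close>, for \<open>A\<close> and \<open>B\<close> with the same number of rows.\<close>

definition juxtapose :: "'a mat \<Rightarrow> 'a mat \<Rightarrow> 'a mat" where
  "juxtapose A B = mat_of_cols (dim_row A) (cols A @ cols B)"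

text \<open>
  \<open>u\<close> is the fixed ordered orthonormal basis of the whole space. The bases of \<open>V\<close> and \<open>W\<close> are
  arbitrarily chosen; another choice multiplies the matrix on the right by a block diagonal unitary
  matrix and leaves the value unchanged.
\<close>

definition delta :: "'e::fd_complex_hilbert list \<Rightarrow> 'e set \<Rightarrow> 'e set \<Rightarrow> real" where
  "delta u V W =
     (let vs = (SOME vs. orthonormal_basis vs V);
          ws = (SOME ws. orthonormal_basis ws W)
      in cmod (det (juxtapose (coord_mat u vs) (coord_mat u ws))))"

text \<open>The projection on \<open>V\<close> along \<open>W\<close>; meaningful when the space is the direct sum of \<open>V\<close> and \<open>W\<close>.\<close>

definition proj_along :: "'e::complex_vector set \<Rightarrow> 'e set \<Rightarrow> 'e \<Rightarrow> 'e" where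
  "proj_along V W x = (THE v. v \<in> V \<and> x - v \<in> W)"

end

theory Submission
  imports Defs
begin

text \<open>
  Write the matrix of \<open>\<delta>(V, W)\<close> as \<open>M = [V|W]\<close>. Since \<open>V \<inter> W = 0\<close> it is invertible, and the coordinates
  of a vector \<open>x\<close> with respect to the juxtaposed bases are given by Cramer's rule as quotients with
  denominator \<open>det M\<close>. The entries of \<open>M\<close> have modulus at most 1, so the numerators are at most
  \<open>d! \<parallel>x\<parallel>\<close>; summing over the basis of \<open>V\<close> gives the estimate with \<open>C = d \<cdot> d!\<close>.
\<close>

section \<open>Complex inner products\<close>

lemma cinner_zero_left [simp]: "cinner 0 (y :: 'a::complex_inner) = 0"
  using cinner_add_left[of 0 0 y] by simp

lemma cinner_sum_left:
  "cinner (\<Sum>i\<in>I. f i) (y :: 'a::complex_inner) = (\<Sum>i\<in>I. cinner (f i) y)"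
  by (induction I rule: infinite_finite_induct) (simp_all add: cinner_add_left)

lemma cinner_diff_left:
  "cinner (x - y) (z :: 'a::complex_inner) = cinner x z - cinner y z"
  by (metis cinner_add_left diff_add_cancel eq_diff_eq)

lemma cinner_scaleC_right: "cinner x (a *\<^sub>C (y :: 'a::complex_inner)) = cnj a * cinner x y"
  by (metis cinner_commute cinner_scaleC_left complex_cnj_mult)

text \<open>The class ties \<open>norm\<close> only to the real inner product, so homogeneity under
  complex scalars is read off from \<open>cinner_self\<close>.\<close>

lemma norm_scaleC: "norm (a *\<^sub>C (x :: 'a::complex_inner)) = cmod a * norm x"
proof -
  have "complex_of_real ((norm (a *\<^sub>C x))\<^sup>2) = a * cnj a * complex_of_real ((norm x)\<^sup>2)"
    by (simp only: cinner_self [symmetric] cinner_scaleC_left cinner_scaleC_right ac_simps)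
  also have "\<dots> = complex_of_real ((cmod a * norm x)\<^sup>2)"
    by (simp only: complex_norm_square power_mult_distrib of_real_mult)
  finally have "(norm (a *\<^sub>C x))\<^sup>2 = (cmod a * norm x)\<^sup>2"
    using of_real_eq_iff by blast
  then show ?thesis
    by (simp add: power2_eq_iff_nonneg)
qed

text \<open>Complex Cauchy-Schwarz follows from the real one: rotating \<open>x\<close> by the
  conjugate phase \<open>a\<close> makes the inner product real and nonnegative without changing the
  norm of \<open>x\<close>.\<close>

lemma cmod_cinner_le: "cmod (cinner x y) \<le> norm x * norm (y :: 'a::complex_inner)"
proof (cases "cinner x y = 0")
  case False
  define a where "a = cnj (sgn (cinner x y))"
  have a: "cmod a = 1"
    using False by (simp add: a_def norm_sgn)
  have "a * cinner x y = complex_of_real (cmod (cinner x y))"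
    using False complex_norm_square[of "cinner x y"]
    by (simp add: a_def sgn_eq field_simps power2_eq_square)
  then have "cmod (cinner x y) = inner (a *\<^sub>C x) y"
    by (simp add: inner_eq_Re_cinner cinner_scaleC_left)
  also have "\<dots> \<le> norm (a *\<^sub>C x) * norm y"
    by (rule norm_cauchy_schwarz)
  finally show ?thesis
    by (simp add: norm_scaleC a)
qed simp

section \<open>Orthonormal bases\<close>

text \<open>Equal entries at different indices would have inner product both 1 and 0, so the list is
  distinct. The set form suits \<open>span\<close>, \<open>dim\<close> and
  \<open>representation\<close>.\<close>

lemma orthonormal_basis_iff:
  "orthonormal_basis vs V \<longleftrightarrow>
     distinct vs \<and> (\<forall>a\<in>set vs. \<forall>b\<in>set vs. cinner a b = (if a = b then 1 else 0)) \<and>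
     complex_vector.span (set vs) = V"
  (is "_ \<longleftrightarrow> ?dist \<and> ?orth \<and> ?span")
proof
  assume onb: "orthonormal_basis vs V"
  have "i = j" if "i < length vs" "j < length vs" "vs ! i = vs ! j" for i j
    using onb that unfolding orthonormal_basis_def by (metis zero_neq_one)
  then have "?dist"
    by (auto simp: distinct_conv_nth)
  moreover have "?orth"
    using onb \<open>?dist\<close> by (auto simp: orthonormal_basis_def in_set_conv_nth nth_eq_iff_index_eq)
  ultimately show "?dist \<and> ?orth \<and> ?span"
    using onb by (simp add: orthonormal_basis_def)
qed (auto simp: orthonormal_basis_def nth_eq_iff_index_eq)

lemma orthonormal_basis_cinner_sum:
  assumes "orthonormal_basis vs V" and "b \<in> set vs"
  shows "cinner (\<Sum>a\<in>set vs. f a *\<^sub>C a) b = f b"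
proof -
  have "cinner (\<Sum>a\<in>set vs. f a *\<^sub>C a) b = (\<Sum>a\<in>set vs. f a * (if a = b then 1 else 0))"
    using assms unfolding orthonormal_basis_iff cinner_sum_left cinner_scaleC_left
    by (intro sum.cong) auto
  also have "\<dots> = f b"
    using assms(2) by (simp add: if_distrib cong: if_cong)
  finally show ?thesis .
qed

lemma orthonormal_basis_independent:
  assumes "orthonormal_basis vs V"
  shows "complex_vector.independent (set vs)"
proof
  assume "complex_vector.dependent (set vs)"
  then obtain f a where "a \<in> set vs" "f a \<noteq> 0" "(\<Sum>b\<in>set vs. f b *\<^sub>C b) = 0"
    by (auto simp: complex_vector.dependent_finite)
  then show False
    using orthonormal_basis_cinner_sum[OF assms, of a f] by simp
qed

lemma orthonormal_basis_length:
  assumes "orthonormal_basis vs V"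
  shows "length vs = complex_vector.dim V"
  using assms orthonormal_basis_independent[OF assms]
  by (auto simp: orthonormal_basis_iff complex_vector.dim_eq_card_independent distinct_card)

text \<open>Turns the algebraic coordinates in \<open>coord_mat\<close> into inner products, which
  Cauchy-Schwarz can bound.\<close>

lemma orthonormal_basis_representation:
  assumes "orthonormal_basis vs V" and "x \<in> V" and "b \<in> set vs"
  shows "complex_vector.representation (set vs) x b = cinner x b"
proof -
  have "(\<Sum>a\<in>set vs. complex_vector.representation (set vs) x a *\<^sub>C a) = x"
    using assms orthonormal_basis_independent[OF assms(1)]
    by (intro complex_vector.sum_representation_eq) (auto simp: orthonormal_basis_iff)
  then show ?thesis
    using orthonormal_basis_cinner_sum[OF assms(1,3), of "complex_vector.representation (set vs) x"]
    by simp
qed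

text \<open>Every vector is the sum of its components along the basis, so vector equations can be
  checked coordinate by coordinate.\<close>

lemma orthonormal_basis_eqI:
  assumes "orthonormal_basis vs UNIV" and "\<And>i. i < length vs \<Longrightarrow> cinner x (vs ! i) = cinner y (vs ! i)"
  shows "x = y"
proof -
  have exp: "(\<Sum>b\<in>set vs. cinner z b *\<^sub>C b) = z" for z
  proof -
    have "(\<Sum>b\<in>set vs. complex_vector.representation (set vs) z b *\<^sub>C b) = z"
      using assms(1) orthonormal_basis_independent[OF assms(1)]
      by (intro complex_vector.sum_representation_eq) (auto simp: orthonormal_basis_iff)
    then show ?thesis
      using orthonormal_basis_representation[OF assms(1)] by simp
  qed
  have "\<forall>b\<in>set vs. cinner x b = cinner y b"
    using assms(2) by (auto simp: in_set_conv_nth)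
  then have "(\<Sum>b\<in>set vs. cinner x b *\<^sub>C b) = (\<Sum>b\<in>set vs. cinner y b *\<^sub>C b)"
    by simp
  then show ?thesis
    by (simp add: exp)
qed

lemma orthonormal_basis_norm:
  assumes "orthonormal_basis vs V" and "b \<in> set vs"
  shows "norm b = 1"
proof -
  have "complex_of_real ((norm b)\<^sup>2) = 1"
    unfolding cinner_self[symmetric] using assms by (simp add: orthonormal_basis_iff)
  then have "(norm b)\<^sup>2 = 1"
    using of_real_eq_1_iff by blast
  then show ?thesis
    by (simp add: power2_eq_1_iff) (metis norm_ge_zero not_one_le_zero neg_0_le_iff_le)
qed

text \<open>One Gram-Schmidt step: \<open>y\<close> is \<open>x\<close> minus its orthogonal
  projection on \<open>V\<close>, nonzero because \<open>x\<close> lies outside \<open>V\<close>,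
  and \<open>e\<close> is \<open>y\<close> normalised.\<close>

lemma orthonormal_basis_extend:
  assumes onb: "orthonormal_basis vs V" and x: "x \<notin> V"
  obtains e where "orthonormal_basis (e # vs) (complex_vector.span (insert x V))"
proof -
  define y where "y = x - (\<Sum>b\<in>set vs. cinner x b *\<^sub>C b)"
  define e where "e = complex_of_real (1 / norm y) *\<^sub>C y"
  have span: "complex_vector.span (set vs) = V"
    using onb by (simp add: orthonormal_basis_iff)
  have sumV: "(\<Sum>b\<in>set vs. cinner x b *\<^sub>C b) \<in> V"
    unfolding span[symmetric]
    by (intro complex_vector.span_sum complex_vector.span_scale complex_vector.span_base)
  then have "y \<noteq> 0"
    using x by (auto simp: y_def)
  have "cinner y b = 0" if "b \<in> set vs" for b
    using orthonormal_basis_cinner_sum[OF onb that] by (simp add: y_def cinner_diff_left)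
  then have eb: "cinner e b = 0" if "b \<in> set vs" for b
    using that by (simp add: e_def cinner_scaleC_left)
  then have be: "cinner b e = 0" if "b \<in> set vs" for b
    using that cinner_commute[of b e] by simp
  have ee: "cinner e e = 1"
    using \<open>y \<noteq> 0\<close> by (simp add: cinner_self e_def norm_scaleC norm_divide)
  have "e \<notin> set vs"
    using eb ee by force
  \<comment> \<open>Undoing the normalisation puts \<open>y\<close>, and hence \<open>x\<close>,
    back in the span of \<open>e # vs\<close>.\<close>
  have y: "y = complex_of_real (norm y) *\<^sub>C e"
    using \<open>y \<noteq> 0\<close> by (simp add: e_def scaleC_scaleC scaleC_one)
  have "complex_vector.span (set (e # vs)) = complex_vector.span (insert x V)"
  proof (rule complex_vector.span_eq[THEN iffD2], intro conjI subsetI)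
    fix z assume "z \<in> set (e # vs)"
    moreover have "y \<in> complex_vector.span (insert x V)"
      unfolding y_def by (intro complex_vector.span_diff complex_vector.span_base) (use sumV in auto)
    then have "e \<in> complex_vector.span (insert x V)"
      unfolding e_def by (rule complex_vector.span_scale)
    ultimately show "z \<in> complex_vector.span (insert x V)"
      using span complex_vector.span_base[of z "set vs"] complex_vector.span_base[of z "insert x V"]
      by auto
  next
    fix z assume "z \<in> insert x V"
    moreover have V: "V \<subseteq> complex_vector.span (set (e # vs))"
      unfolding span[symmetric] by (intro complex_vector.span_mono) auto
    moreover have "y \<in> complex_vector.span (set (e # vs))"
      by (subst y, intro complex_vector.span_scale complex_vector.span_base) auto
    then have "x \<in> complex_vector.span (set (e # vs))"
      using complex_vector.span_add[of y "set (e # vs)" "\<Sum>b\<in>set vs. cinner x b *\<^sub>C b"] sumV V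
      by (auto simp: y_def)
    ultimately show "z \<in> complex_vector.span (set (e # vs))"
      by auto
  qed
  then have "orthonormal_basis (e # vs) (complex_vector.span (insert x V))"
    using onb eb be ee \<open>e \<notin> set vs\<close> by (auto simp: orthonormal_basis_iff)
  then show thesis
    by (rule that)
qed

text \<open>An orthonormal list in \<open>V\<close> of greatest length must span \<open>V\<close>,
  since otherwise a Gram-Schmidt step would lengthen it.\<close>

lemma exists_orthonormal_basis:
  fixes V :: "'a::fd_complex_hilbert set"
  assumes V: "complex_vector.subspace V"
  shows "\<exists>vs. orthonormal_basis vs V"
proof -
  define P where "P vs \<longleftrightarrow> (\<exists>S\<subseteq>V. orthonormal_basis vs S)" for vs :: "'a list"
  obtain B :: "'a set" where B: "finite B" "\<forall>x. \<exists>f. x = (\<Sum>b\<in>B. f b *\<^sub>C b)"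
    using finite_spanning_set by blast
  have spanB: "x \<in> complex_vector.span B" for x
  proof -
    obtain f where "x = (\<Sum>b\<in>B. f b *\<^sub>C b)"
      using B(2) by blast
    then show ?thesis
      by (simp add: complex_vector.span_base complex_vector.span_scale complex_vector.span_sum)
  qed
  \<comment> \<open>Orthonormal lists are independent, so a finite spanning set bounds their length
    and a longest one exists.\<close>
  have "length vs < Suc (card B)" if P: "P vs" for vs
  proof -
    obtain S where S: "orthonormal_basis vs S"
      using P by (auto simp: P_def)
    have "card (set vs) \<le> card B"
      using complex_vector.independent_span_bound[OF B(1) orthonormal_basis_independent[OF S]] spanB
      by blast
    then show ?thesis
      using S by (simp add: orthonormal_basis_iff distinct_card)
  qed
  moreover have "P []"
    unfolding P_def using complex_vector.subspace_0[OF V]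
    by (intro exI[of _ "{0}"]) (simp add: orthonormal_basis_iff)
  ultimately obtain vs where vs: "P vs" and max: "\<And>ws. P ws \<Longrightarrow> length ws \<le> length vs"
    using ex_has_greatest_nat[of P "[]" length "Suc (card B)"] by (auto simp: less_imp_le)
  obtain S where S: "S \<subseteq> V" "orthonormal_basis vs S"
    using vs by (auto simp: P_def)
  have "S = V"
  proof (rule ccontr)
    assume "S \<noteq> V"
    then obtain x where x: "x \<in> V" "x \<notin> S"
      using S(1) by blast
    obtain e where "orthonormal_basis (e # vs) (complex_vector.span (insert x S))"
      using orthonormal_basis_extend[OF S(2) x(2)] by blast
    moreover have "complex_vector.span (insert x S) \<subseteq> V"
      using S(1) x(1) V by (intro complex_vector.span_minimal) auto
    ultimately have "P (e # vs)"
      unfolding P_def by blast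
    from max[OF this] show False
      by simp
  qed
  then show ?thesis
    using S(2) by blast
qed

section \<open>Coordinates and Cramer's rule\<close>

text \<open>The Leibniz formula has \<open>fact n\<close> terms, each taking one entry from every
  column. Bounds that vary with the column let a single replaced column in Cramer's rule carry the
  norm of the vector.\<close>

lemma cmod_det_le:
  fixes A :: "complex mat"
  assumes A: "A \<in> carrier_mat n n"
    and le: "\<And>i j. i < n \<Longrightarrow> j < n \<Longrightarrow> cmod (A $$ (i, j)) \<le> B j"
  shows "cmod (det A) \<le> fact n * (\<Prod>j<n. B j)"
proof -
  have "cmod (signof p * (\<Prod>i = 0..<n. A $$ (i, p i))) \<le> (\<Prod>j<n. B j)"
    if p: "p permutes {0..<n}" for p
  proof -
    have "cmod (signof p :: complex) = 1"
      by (simp add: sign_def)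
    then have "cmod (signof p * (\<Prod>i = 0..<n. A $$ (i, p i))) = (\<Prod>i = 0..<n. cmod (A $$ (i, p i)))"
      by (simp add: norm_mult prod_norm)
    also have "\<dots> \<le> (\<Prod>i = 0..<n. B (p i))"
      using permutes_in_image[OF p] by (intro prod_mono) (auto intro!: le)
    \<comment> \<open>Reindexing along the permutation \<open>p\<close>.\<close>
    also have "\<dots> = (\<Prod>j = 0..<n. B j)"
      using prod.permute[OF p, of B] by (simp add: o_def)
    finally show ?thesis
      by (simp add: atLeast0LessThan)
  qed
  then have "cmod (det A) \<le> of_nat (card {p. p permutes {0..<n}}) * (\<Prod>j<n. B j)"
    unfolding det_def'[OF A] by (intro sum_norm_bound) auto
  then show ?thesis
    by (simp add: card_permutations[of _ n])
qed

text \<open>Allows the block matrix to be handled as the coordinate matrix of the single list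
  \<open>vs @ ws\<close>.\<close>

lemma juxtapose_coord_mat:
  "juxtapose (coord_mat u vs) (coord_mat u ws) = coord_mat u (vs @ ws)"
  by (rule eq_matI)
    (auto simp: juxtapose_def coord_mat_def mat_of_cols_index nth_append)

lemma coord_mat_carrier [simp]: "coord_mat u bs \<in> carrier_mat (length u) (length bs)"
  by (simp add: coord_mat_def)

lemma coord_mat_index:
  assumes "orthonormal_basis u UNIV" and "i < length u" and "j < length bs"
  shows "coord_mat u bs $$ (i, j) = cinner (bs ! j) (u ! i)"
  using assms by (simp add: coord_mat_def orthonormal_basis_representation)

text \<open>The matrix turns coefficients with respect to \<open>bs\<close> into coordinates with
  respect to \<open>u\<close>.\<close>

lemma coord_mat_mult_vec:
  assumes u: "orthonormal_basis u UNIV" and c: "c \<in> carrier_vec (length bs)"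
  shows "coord_mat u bs *\<^sub>v c = vec (length u) (\<lambda>i. cinner (\<Sum>j<length bs. c $ j *\<^sub>C bs ! j) (u ! i))"
proof (rule eq_vecI)
  fix i assume "i < dim_vec (vec (length u) (\<lambda>i. cinner (\<Sum>j<length bs. c $ j *\<^sub>C bs ! j) (u ! i)))"
  then have i: "i < length u"
    by simp
  then have "(coord_mat u bs *\<^sub>v c) $ i = (\<Sum>j = 0..<length bs. coord_mat u bs $$ (i, j) * c $ j)"
    using c by (simp add: coord_mat_def scalar_prod_def)
  also have "\<dots> = (\<Sum>j<length bs. cinner (bs ! j) (u ! i) * c $ j)"
    using i by (simp add: coord_mat_index[OF u] atLeast0LessThan)
  finally show "(coord_mat u bs *\<^sub>v c) $ i =
      vec (length u) (\<lambda>i. cinner (\<Sum>j<length bs. c $ j *\<^sub>C bs ! j) (u ! i)) $ i"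
    using i by (simp add: cinner_sum_left cinner_scaleC_left mult.commute)
qed (simp add: coord_mat_def)

text \<open>By Cramer's rule the left side is the modulus of the determinant with column
  \<open>k\<close> replaced by the coordinates of the combination. Cauchy-Schwarz bounds that column
  by its norm and all other entries by 1.\<close>

lemma coord_mat_cramer_bound:
  assumes u: "orthonormal_basis u UNIV" and len: "length bs = length u"
    and unit: "\<And>b. b \<in> set bs \<Longrightarrow> norm b = 1"
    and c: "c \<in> carrier_vec (length bs)" and k: "k < length bs"
  shows "cmod (c $ k) * cmod (det (coord_mat u bs)) \<le>
           fact (length u) * norm (\<Sum>j<length bs. c $ j *\<^sub>C bs ! j)"
proof -
  define x where "x = (\<Sum>j<length bs. c $ j *\<^sub>C bs ! j)"
  define A where "A = coord_mat u bs"
  have A: "A \<in> carrier_mat (length u) (length u)"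
    using coord_mat_carrier[of u bs] by (simp add: A_def len)
  have Ac: "A *\<^sub>v c = vec (length u) (\<lambda>i. cinner x (u ! i))"
    using coord_mat_mult_vec[OF u c] by (simp add: A_def x_def)
  have nu: "norm (u ! i) = 1" if "i < length u" for i
    using that by (simp add: orthonormal_basis_norm[OF u])
  have "cmod (c $ k) * cmod (det A) = cmod (det (replace_col A (A *\<^sub>v c) k))"
    using cramer_lemma_mat[OF A, of c k] c k len by (simp add: norm_mult)
  also have "\<dots> \<le> fact (length u) * (\<Prod>j<length u. if j = k then norm x else 1)"
  proof (rule cmod_det_le)
    show "replace_col A (A *\<^sub>v c) k \<in> carrier_mat (length u) (length u)"
      using A by (simp add: replace_col_def)
    fix i j assume ij: "i < length u" "j < length u"
    have "cmod (A $$ (i, j)) \<le> 1"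
      using cmod_cinner_le[of "bs ! j" "u ! i"] ij len nu unit
      by (simp add: A_def coord_mat_index[OF u])
    then show "cmod (replace_col A (A *\<^sub>v c) k $$ (i, j)) \<le> (if j = k then norm x else 1)"
      using A ij cmod_cinner_le[of x "u ! i"] nu by (simp add: replace_col_def Ac)
  qed
  also have "(\<Prod>j<length u. if j = k then norm x else 1) = norm x"
    using k len by simp
  finally show ?thesis
    by (simp add: A_def x_def)
qed

lemma sum_lessThan_add:
  fixes f :: "nat \<Rightarrow> 'a::comm_monoid_add"
  shows "(\<Sum>j<p + q. f j) = (\<Sum>j<p. f j) + (\<Sum>j<q. f (p + j))"
  by (induction q) (simp_all add: add.assoc)

lemma sum_scaleC_append:
  "(\<Sum>j<length (vs @ ws). c j *\<^sub>C (vs @ ws) ! j) =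
   (\<Sum>j<length vs. c j *\<^sub>C vs ! j) + (\<Sum>j<length ws. c (length vs + j) *\<^sub>C ws ! j)"
  by (simp add: sum_lessThan_add nth_append)

lemma sum_scaleC_in_span: "(\<Sum>j<length vs. c j *\<^sub>C vs ! j) \<in> complex_vector.span (set vs)"
  by (intro complex_vector.span_sum complex_vector.span_scale complex_vector.span_base) simp

lemma orthonormal_basis_sum_eq_0:
  assumes "orthonormal_basis vs V" and "(\<Sum>j<length vs. c j *\<^sub>C vs ! j) = 0" and "k < length vs"
  shows "c k = 0"
proof -
  have "0 = cinner (\<Sum>j<length vs. c j *\<^sub>C vs ! j) (vs ! k)"
    by (simp add: assms(2))
  also have "\<dots> = (\<Sum>j<length vs. c j * (if j = k then 1 else 0))"
    using assms(1,3) unfolding orthonormal_basis_def cinner_sum_left cinner_scaleC_left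
    by (intro sum.cong) auto
  also have "\<dots> = c k"
    using assms(3) by (simp add: if_distrib cong: if_cong)
  finally show ?thesis
    by simp
qed

text \<open>A kernel vector \<open>c\<close> would give \<open>v + w = 0\<close> with
  \<open>v\<close> in \<open>V\<close> and \<open>w\<close> in \<open>W\<close>. Then
  \<open>v = - w\<close> lies in the trivial intersection, both parts vanish, and orthonormality
  forces \<open>c = 0\<close>.\<close>

lemma det_coord_mat_neq_0:
  assumes u: "orthonormal_basis u UNIV" and vs: "orthonormal_basis vs V" and ws: "orthonormal_basis ws W"
    and len: "length (vs @ ws) = length u" and VW: "V \<inter> W = {0}"
  shows "det (coord_mat u (vs @ ws)) \<noteq> 0"
proof
  assume "det (coord_mat u (vs @ ws)) = 0"
  moreover have "coord_mat u (vs @ ws) \<in> carrier_mat (length u) (length u)"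
    using coord_mat_carrier[of u "vs @ ws"] by (simp only: len)
  ultimately obtain c where c: "c \<in> carrier_vec (length u)" "c \<noteq> 0\<^sub>v (length u)"
    and z: "coord_mat u (vs @ ws) *\<^sub>v c = 0\<^sub>v (length u)"
    using det_0_iff_vec_prod_zero_field by blast
  define v where "v = (\<Sum>j<length vs. c $ j *\<^sub>C vs ! j)"
  define w where "w = (\<Sum>j<length ws. c $ (length vs + j) *\<^sub>C ws ! j)"
  have "cinner (v + w) (u ! i) = 0" if "i < length u" for i
    using arg_cong[OF z, of "\<lambda>y. y $ i"] that c(1) coord_mat_mult_vec[OF u, of c "vs @ ws"] len
    unfolding v_def w_def sum_scaleC_append[symmetric] by simp
  then have vw: "v + w = 0"
    by (intro orthonormal_basis_eqI[OF u]) simp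
  have V: "v \<in> V" and W: "w \<in> W" and subW: "complex_vector.subspace W"
    using sum_scaleC_in_span[of _ vs] sum_scaleC_in_span[of _ ws] vs ws
    by (auto simp: v_def w_def orthonormal_basis_iff)
  have "v = - w"
    using vw by (simp add: eq_neg_iff_add_eq_0)
  then have "v \<in> W"
    using complex_vector.subspace_neg[OF subW W] by simp
  then have "v = 0"
    using V VW by blast
  then have "w = 0"
    using vw by simp
  have "c $ j = 0" if "j < length u" for j
  proof (cases "j < length vs")
    case True
    then show ?thesis
      using orthonormal_basis_sum_eq_0[OF vs, of "\<lambda>j. c $ j"] \<open>v = 0\<close> by (simp add: v_def)
  next
    case False
    then show ?thesis
      using orthonormal_basis_sum_eq_0[OF ws, of "\<lambda>j. c $ (length vs + j)" "j - length vs"]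
        \<open>w = 0\<close> that len by (simp add: w_def)
  qed
  then show False
    using c by (auto intro!: eq_vecI)
qed

text \<open>The coefficients are obtained by applying the inverse matrix to the coordinates of
  \<open>x\<close> in \<open>u\<close>.\<close>

lemma coord_mat_expansion:
  assumes u: "orthonormal_basis u UNIV" and len: "length bs = length u"
    and det: "det (coord_mat u bs) \<noteq> 0"
  obtains c where "c \<in> carrier_vec (length bs)" and "x = (\<Sum>j<length bs. c $ j *\<^sub>C bs ! j)"
proof -
  define A where "A = coord_mat u bs"
  define y where "y = vec (length u) (\<lambda>i. cinner x (u ! i))"
  have A: "A \<in> carrier_mat (length u) (length u)"
    using coord_mat_carrier[of u bs] by (simp add: A_def len)
  obtain B where B: "B \<in> carrier_mat (length u) (length u)" "A * B = 1\<^sub>m (length u)"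
    \<comment> \<open>\<open>undefined\<close> fills the record extension slot of the matrix ring,
      which does not affect its units.\<close>
    using det_non_zero_imp_unit[OF A, of undefined] det
    by (auto simp: A_def Units_def ring_mat_simps)
  define c where "c = B *\<^sub>v y"
  have c: "c \<in> carrier_vec (length bs)"
    unfolding c_def len by (rule mult_mat_vec_carrier[OF B(1)]) (simp add: y_def)
  have "A *\<^sub>v c = (A * B) *\<^sub>v y"
    unfolding c_def by (rule assoc_mult_mat_vec[OF A B(1), symmetric]) (simp add: y_def)
  then have "A *\<^sub>v c = y"
    by (simp add: B(2) y_def)
  then have eq: "vec (length u) (\<lambda>i. cinner (\<Sum>j<length bs. c $ j *\<^sub>C bs ! j) (u ! i)) = y"
    using coord_mat_mult_vec[OF u c] by (simp add: A_def)
  have "x = (\<Sum>j<length bs. c $ j *\<^sub>C bs ! j)"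
  proof (rule orthonormal_basis_eqI[OF u])
    fix i assume "i < length u"
    then show "cinner x (u ! i) = cinner (\<Sum>j<length bs. c $ j *\<^sub>C bs ! j) (u ! i)"
      using arg_cong[OF eq, of "\<lambda>z. z $ i"] by (simp add: y_def)
  qed
  with c show thesis
    by (rule that)
qed

section \<open>The projection\<close>

text \<open>Two candidates for the component in \<open>V\<close> differ by an element of both
  \<open>V\<close> and \<open>W\<close>, so the definite description is determined.\<close>

lemma proj_along_add:
  assumes V: "complex_vector.subspace V" and W: "complex_vector.subspace W" and VW: "V \<inter> W = {0}"
    and v: "v \<in> V" and w: "w \<in> W"
  shows "proj_along V W (v + w) = v"
  unfolding proj_along_def
proof (rule the_equality)
  fix v' assume v': "v' \<in> V \<and> v + w - v' \<in> W"
  have "v - v' \<in> V"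
    using v v' complex_vector.subspace_diff[OF V] by blast
  moreover have "v - v' \<in> W"
    using complex_vector.subspace_diff[OF W, of "v + w - v'" w] v' w by (simp add: algebra_simps)
  ultimately have "v - v' = 0"
    using VW by blast
  then show "v' = v"
    by simp
qed (use v w in simp)

text \<open>The projection keeps the \<open>vs\<close> part of the expansion of \<open>x\<close>;
  each coefficient obeys the Cramer bound and multiplies a unit vector.\<close>

lemma norm_proj_along_le:
  assumes u: "orthonormal_basis u UNIV" and vs: "orthonormal_basis vs V" and ws: "orthonormal_basis ws W"
    and len: "length (vs @ ws) = length u" and VW: "V \<inter> W = {0}"
  shows "norm (proj_along V W x) \<le>
           length u * fact (length u) / cmod (det (coord_mat u (vs @ ws))) * norm x"
proof -
  let ?D = "cmod (det (coord_mat u (vs @ ws)))"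
  have D: "?D > 0"
    using det_coord_mat_neq_0[OF assms] by simp
  obtain c where c: "c \<in> carrier_vec (length (vs @ ws))"
    and x: "x = (\<Sum>j<length (vs @ ws). c $ j *\<^sub>C (vs @ ws) ! j)"
    using coord_mat_expansion[OF u len det_coord_mat_neq_0[OF assms], of x] by blast
  have V: "complex_vector.span (set vs) = V" and W: "complex_vector.span (set ws) = W"
    using vs ws by (simp_all add: orthonormal_basis_iff)
  have unit: "norm b = 1" if "b \<in> set (vs @ ws)" for b
    using that orthonormal_basis_norm[OF vs] orthonormal_basis_norm[OF ws] by auto
  have "proj_along V W x = (\<Sum>j<length vs. c $ j *\<^sub>C vs ! j)"
    unfolding x sum_scaleC_append
    using sum_scaleC_in_span[of _ vs] sum_scaleC_in_span[of _ ws] V W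
    by (intro proj_along_add VW) auto
  also have "norm \<dots> \<le> (\<Sum>j<length vs. fact (length u) * norm x / ?D)"
  proof (rule sum_norm_le)
    fix j assume j: "j \<in> {..<length vs}"
    then have "cmod (c $ j) * ?D \<le> fact (length u) * norm x"
      using coord_mat_cramer_bound[OF u len unit c, of j] by (simp add: x)
    then show "norm (c $ j *\<^sub>C vs ! j) \<le> fact (length u) * norm x / ?D"
      using j D unit[of "vs ! j"] by (simp add: norm_scaleC pos_le_divide_eq)
  qed
  also have "\<dots> = length vs * (fact (length u) * norm x / ?D)"
    by simp
  \<comment> \<open>Enlarging \<open>length vs\<close> to \<open>length u\<close> makes the
    numerator depend on the dimension of the whole space alone.\<close>
  also have "\<dots> \<le> length u * (fact (length u) * norm x / ?D)"
    using len by (intro mult_right_mono) auto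
  finally show ?thesis
    by simp
qed

theorem lemma5p25:
  fixes u :: "'e::fd_complex_hilbert list"
    and W :: "'e set"
    and d d\<^sub>0 :: nat
  assumes "orthonormal_basis u (UNIV :: 'e set)"
    and "d = complex_vector.dim (UNIV :: 'e set)"
    and "0 < d\<^sub>0" and "d\<^sub>0 < d"
    and "W \<in> Gr d\<^sub>0"
  shows "\<exists>C::real. \<forall>V \<in> Gr (d - d\<^sub>0) - frakV W.
           onorm (proj_along V W) \<le> C / delta u V W"
proof (intro exI ballI)
  fix V assume V: "V \<in> Gr (d - d\<^sub>0) - frakV W"
  \<comment> \<open>The same choice terms as in \<open>delta\<close>, so that unfolding it produces
    exactly these bases.\<close>
  define vs where "vs = (SOME vs. orthonormal_basis vs V)"
  define ws where "ws = (SOME ws. orthonormal_basis ws W)"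
  have vs: "orthonormal_basis vs V"
    unfolding vs_def using V by (intro someI_ex[OF exists_orthonormal_basis]) (simp add: Gr_def)
  have ws: "orthonormal_basis ws W"
    unfolding ws_def using assms(5)
    by (intro someI_ex[OF exists_orthonormal_basis]) (simp add: Gr_def)
  \<comment> \<open>Since \<open>W\<close> has dimension \<open>d\<^sub>0\<close>, the Grassmannian
    inside \<open>frakV W\<close> is \<open>Gr (d - d\<^sub>0)\<close>, so lying outside
    \<open>frakV W\<close> means trivial intersection.\<close>
  have VW: "V \<inter> W = {0}"
    using V assms(2,5) by (auto simp: frakV_def Gr_def)
  \<comment> \<open>The truncated difference \<open>d - d\<^sub>0\<close> adds up with
    \<open>d\<^sub>0\<close> to \<open>d\<close> because \<open>d\<^sub>0 < d\<close>.\<close>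
  have len: "length (vs @ ws) = length u"
    using V assms(2,4,5) by (simp add: orthonormal_basis_length[OF vs] orthonormal_basis_length[OF ws]
        orthonormal_basis_length[OF assms(1)] Gr_def)
  have delta: "delta u V W = cmod (det (coord_mat u (vs @ ws)))"
    by (simp add: delta_def Let_def vs_def ws_def juxtapose_coord_mat)
  \<comment> \<open>The witness for \<open>C\<close> is \<open>d\<close> times
    \<open>fact d\<close>, with \<open>d\<close> as the length of \<open>u\<close>; it was left open
    before \<open>V\<close> was fixed, so it cannot depend on \<open>V\<close>.\<close>
  show "onorm (proj_along V W) \<le> (real (length u) * fact (length u)) / delta u V W"
    unfolding delta using norm_proj_along_le[OF assms(1) vs ws len VW]
    by (intro onorm_bound) auto
qed

end
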